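(* Let $a_1,a_2>0$. The multiple Charlier polynomials $C_{n_1,n_2}^{(a_1,a_2)}(x)$ have the generating function $$e^{-(a_1t_1+a_2t_2)}\big(1+t_1+t_2\big)^x=\sum_{n_1=0}^{\infty}\sum_{n_2=0}^{\infty}C_{n_1,n_2}^{(a_1,a_2)}(x)\,\frac{t_1^{n_1}}{n_1!}\frac{t_2^{n_2}}{n_2!},$$ as an identity of formal power series in $t_1,t_2$.
   Context: For an integer $n\ge 0$, $x^{(n,1)}=x(x-1)\cdots(x-n+1)$ denotes the falling factorial, with $x^{(0,1)}=1$. For parameters $a_1,a_2>0$ and integers $n_1,n_2\ge 0$, the multiple Charlier polynomials (for $r=2$ weights $a_i^x/\Gamma(x+1)$, $x=0,1,2,\ldots$) are given by $$C_{n_1,n_2}^{(a_1,a_2)}(x)=\sum_{k=0}^{n_1}\sum_{\ell=0}^{n_2}\binom{n_1}{k}\binom{n_2}{\ell}(-a_1)^{n_1-k}(-a_2)^{n_2-\ell}\,x^{(k+\ell,1)}.$$ The power $(1+t_1+t_2)^x$ is understood as its binomial expansion $\sum_{k\ge 0} x^{(k,1)}\frac{(t_1+t_2)^k}{k!}$. *)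

theory Defs
  imports "HOL-Computational_Algebra.Formal_Power_Series" "HOL-Library.Groups_Big_Fun"
begin

text \<open>
  Formal power series in \<open>t\<^sub>1, t\<^sub>2\<close> over \<open>'a\<close> are the elements of \<open>'a[[t\<^sub>1]][[t\<^sub>2]]\<close>:
  the outer series variable is \<open>t\<^sub>2\<close>, and its coefficients are series in \<open>t\<^sub>1\<close>.
\<close>

type_synonym 'a fps2 = "'a fps fps"

definition fps2_nth :: "'a fps2 \<Rightarrow> nat \<Rightarrow> nat \<Rightarrow> 'a" where
  "fps2_nth F m n = fps_nth (fps_nth F n) m"

definition fps2_const :: "'a::zero \<Rightarrow> 'a fps2" where
  "fps2_const c = fps_const (fps_const c)"

definition T1 :: "'a::comm_ring_1 fps2" where
  "T1 = fps_const fps_X"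

definition T2 :: "'a::comm_ring_1 fps2" where
  "T2 = fps_X"

text \<open>
  Infinite sums of bivariate series are formal: every coefficient of the sum is a sum with
  only finitely many nonzero terms. (The topology that the library puts on \<open>'a fps fps\<close> is
  the \<open>t\<^sub>2\<close>-adic one, with discrete coefficients; \<open>\<Sum>\<^sub>k t\<^sub>1\<^sup>k\<close> does not converge in it, so the
  library's infinite sums cannot be used.) On a family that is not
  \<open>fps2_summable\<close>, \<open>fps2_suminf\<close> has the junk value \<open>0\<close> in the offending coefficients;
  the lemmas below show that this does not happen for the families that matter here.
\<close>

definition fps2_summable :: "(nat \<Rightarrow> 'a::comm_monoid_add fps2) \<Rightarrow> bool" where
  "fps2_summable f \<longleftrightarrow> (\<forall>m n. finite {k. fps2_nth (f k) m n \<noteq> 0})"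

definition fps2_suminf :: "(nat \<Rightarrow> 'a::comm_monoid_add fps2) \<Rightarrow> 'a fps2" where
  "fps2_suminf f = Abs_fps (\<lambda>n. Abs_fps (\<lambda>m. Sum_any (\<lambda>k. fps2_nth (f k) m n)))"

text \<open>\<open>x\<^bsup>(n,1)\<^esup> = x (x - 1) \<dots> (x - n + 1)\<close>\<close>

definition falling_factorial :: "'a::comm_ring_1 \<Rightarrow> nat \<Rightarrow> 'a" where
  "falling_factorial x n = (\<Prod>i<n. x - of_nat i)"

text \<open>
  \<open>e\<^sup>G\<close> and \<open>(1 + G)\<^sup>x\<close>, for a series \<open>G\<close> with zero constant coefficient. Composition
  \<open>fps_compose\<close> of the library is not applicable, since it needs
  \<open>fps_nth G 0 = 0\<close>, i.e. divisibility of \<open>G\<close> by \<open>t\<^sub>2\<close>.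
\<close>

definition fps2_exp :: "'a::real_field fps2 \<Rightarrow> 'a fps2" where
  "fps2_exp G = fps2_suminf (\<lambda>k. fps2_const (1 / fact k) * G ^ k)"

definition fps2_one_plus_powr :: "'a::real_field fps2 \<Rightarrow> 'a \<Rightarrow> 'a fps2" where
  "fps2_one_plus_powr G x =
     fps2_suminf (\<lambda>k. fps2_const (falling_factorial x k / fact k) * G ^ k)"

definition charlier :: "real \<Rightarrow> real \<Rightarrow> nat \<Rightarrow> nat \<Rightarrow> 'a::real_field \<Rightarrow> 'a" where
  "charlier a1 a2 n1 n2 x =
     (\<Sum>k=0..n1. \<Sum>l=0..n2. of_nat (n1 choose k) * of_nat (n2 choose l) *
        (- of_real a1) ^ (n1 - k) * (- of_real a2) ^ (n2 - l) * falling_factorial x (k + l))"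

lemma fps2_nth_suminf:
  "fps2_nth (fps2_suminf f) m n = Sum_any (\<lambda>k. fps2_nth (f k) m n)"
  by (simp add: fps2_nth_def fps2_suminf_def)

lemma fps2_nth_const_mult:
  "fps2_nth (fps2_const c * F) m n = c * fps2_nth F m n" for c :: "'a::comm_ring_1"
  by (simp add: fps2_nth_def fps2_const_def)

lemma fps2_nth_T1_T2_power:
  "fps2_nth (T1 ^ i * T2 ^ j) m n = (if m = i \<and> n = j then 1 else 0 :: 'a::comm_ring_1)"
  by (simp add: fps2_nth_def T1_def T2_def fps_X_power_iff)

lemma fps2_nth_power_eq_0:
  fixes G :: "'a::comm_ring_1 fps2"
  assumes "fps2_nth G 0 0 = 0" and "m + n < k"
  shows "fps2_nth (G ^ k) m n = 0"
  using assms(2)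
proof (induction k arbitrary: m n)
  case (Suc k)
  have "fps_nth (fps_nth G j) i * fps_nth (fps_nth (G ^ k) (n - j)) (m - i) = 0"
    if "i \<le> m" "j \<le> n" for i j
  proof (cases "i = 0 \<and> j = 0")
    case True
    then show ?thesis using assms(1) by (simp add: fps2_nth_def)
  next
    case False
    with that Suc.prems have "(m - i) + (n - j) < k" by auto
    from Suc.IH[OF this] show ?thesis by (simp add: fps2_nth_def)
  qed
  then show ?case
    by (simp add: fps2_nth_def fps_mult_nth fps_sum_nth)
qed simp

lemma fps2_summable_power:
  fixes G :: "'a::comm_ring_1 fps2"
  assumes "fps2_nth G 0 0 = 0"
  shows "fps2_summable (\<lambda>k. fps2_const (c k) * G ^ k)"
  unfolding fps2_summable_def
proof (intro allI)
  fix m n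
  have "{k. fps2_nth (fps2_const (c k) * G ^ k) m n \<noteq> 0} \<subseteq> {..m + n}"
    using fps2_nth_power_eq_0[OF assms, of m n]
    by (force simp: fps2_nth_const_mult not_less[symmetric])
  then show "finite {k. fps2_nth (fps2_const (c k) * G ^ k) m n \<noteq> 0}"
    by (rule finite_subset) simp
qed

lemma fps2_nth_T1_T2_constant:
  "fps2_nth (T1 + T2 :: 'a::comm_ring_1 fps2) 0 0 = 0"
  "fps2_nth (- (fps2_const a * T1 + fps2_const b * T2) :: 'a fps2) 0 0 = 0"
  by (simp_all add: fps2_nth_def fps2_const_def T1_def T2_def)

lemma fps2_summable_double_inner:
  "fps2_summable (\<lambda>j. fps2_const (c j) * (T1 ^ i * T2 ^ j) :: 'a::comm_ring_1 fps2)"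
  unfolding fps2_summable_def
proof (intro allI)
  fix m n
  show "finite {j. fps2_nth (fps2_const (c j) * (T1 ^ i * T2 ^ j) :: 'a fps2) m n \<noteq> 0}"
    by (rule finite_subset[of _ "{n}"])
       (auto simp: fps2_nth_const_mult fps2_nth_T1_T2_power split: if_splits)
qed

lemma fps2_nth_suminf_inner:
  "fps2_nth (fps2_suminf (\<lambda>j. fps2_const (c j) * (T1 ^ i * T2 ^ j) :: 'a::comm_ring_1 fps2)) m n
     = (if m = i then c n else 0)"
proof -
  have "Sum_any (\<lambda>j. fps2_nth (fps2_const (c j) * (T1 ^ i * T2 ^ j) :: 'a fps2) m n)
      = (\<Sum>j\<in>{n}. fps2_nth (fps2_const (c j) * (T1 ^ i * T2 ^ j) :: 'a fps2) m n)"
    by (rule Sum_any.expand_superset)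
       (auto simp: fps2_nth_const_mult fps2_nth_T1_T2_power split: if_splits)
  then show ?thesis
    by (simp add: fps2_nth_suminf fps2_nth_const_mult fps2_nth_T1_T2_power)
qed

lemma fps2_summable_double_outer:
  "fps2_summable
     (\<lambda>i. fps2_suminf (\<lambda>j. fps2_const (c i j) * (T1 ^ i * T2 ^ j) :: 'a::comm_ring_1 fps2))"
  by (simp add: fps2_summable_def fps2_nth_suminf_inner)

end

theory Submission
  imports Defs
begin

text \<open>
  The series \<open>t\<^sub>1 + t\<^sub>2\<close> and \<open>- (a\<^sub>1 t\<^sub>1 + a\<^sub>2 t\<^sub>2)\<close> are linear forms, so the coefficient of
  \<open>t\<^sub>1\<^sup>m t\<^sub>2\<^sup>n\<close> in a power series \<open>\<Sum>\<^sub>k f k / k! (c t\<^sub>1 + d t\<^sub>2)\<^sup>k\<close> comes from \<open>k = m + n\<close> alone and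
  equals \<open>f (m + n) c\<^sup>m d\<^sup>n / (m! n!)\<close>. The Cauchy product of two such series then is
  the double binomial sum that defines the Charlier polynomials.
\<close>

lemma fps2_eqI: "(\<And>m n. fps2_nth F m n = fps2_nth G m n) \<Longrightarrow> F = G"
  by (simp add: fps2_nth_def fps_eq_iff)

lemma fps2_nth_sum: "fps2_nth (sum F A) m n = (\<Sum>i\<in>A. fps2_nth (F i) m n)"
  by (simp add: fps2_nth_def fps_sum_nth)

lemma fps2_nth_mult:
  "fps2_nth (F * G) m n =
     (\<Sum>i=0..m. \<Sum>j=0..n. fps2_nth F i j * fps2_nth G (m - i) (n - j))"
  for F G :: "'a::comm_ring_1 fps2"
  \<comment> \<open>The outer convolution runs over the exponent of \<open>t\<^sub>2\<close>, so
    unfolding gives the two sums in the opposite order.\<close>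
  unfolding fps2_nth_def fps_mult_nth fps_sum_nth by (rule sum.swap)

lemma fps2_const_1 [simp]: "fps2_const 1 = 1"
  by (simp add: fps2_const_def)

lemma fps2_const_uminus: "fps2_const (- c) = - fps2_const c" for c :: "'a::comm_ring_1"
  by (simp add: fps2_const_def)

lemma fps2_const_mult: "fps2_const c * fps2_const d = fps2_const (c * d)"
  for c d :: "'a::comm_ring_1"
  by (simp add: fps2_const_def)

lemma fps2_const_power: "fps2_const c ^ n = fps2_const (c ^ n)" for c :: "'a::comm_ring_1"
  by (simp add: fps2_const_def fps_const_power)

lemma fps2_const_of_nat: "fps2_const (of_nat n :: 'a::comm_ring_1) = of_nat n"
  by (simp add: fps2_const_def fps_of_nat)

lemma fps2_nth_linear_power:
  fixes c d :: "'a::comm_ring_1"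
  shows "fps2_nth ((fps2_const c * T1 + fps2_const d * T2) ^ k) m n =
           (if k = m + n then of_nat (k choose m) * c ^ m * d ^ n else 0)"
proof -
  have "(fps2_const c * T1 + fps2_const d * T2) ^ k =
      (\<Sum>i\<le>k. fps2_const (of_nat (k choose i) * c ^ i * d ^ (k - i)) * (T1 ^ i * T2 ^ (k - i)))"
    unfolding binomial_ring
    by (simp add: power_mult_distrib fps2_const_power mult.assoc mult.left_commute
        flip: fps2_const_mult fps2_const_of_nat)
  \<comment> \<open>Only the monomial with \<open>i = m\<close> can contribute. If
    \<open>m > k\<close>, no index matches and the sum is 0; otherwise the truncated
    \<open>n = k - m\<close> means \<open>k = m + n\<close>.\<close>
  then have "fps2_nth ((fps2_const c * T1 + fps2_const d * T2) ^ k) m n =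
      (\<Sum>i\<le>k. if i = m then if n = k - m then of_nat (k choose m) * c ^ m * d ^ n else 0 else 0)"
    by (simp only: fps2_nth_sum)
      (rule sum.cong, auto simp: fps2_nth_const_mult fps2_nth_T1_T2_power)
  then show ?thesis
    by auto
qed

text \<open>The weights \<open>f\<close> stay arbitrary to serve both series: constant 1 gives the
  exponential, the falling factorials give the binomial series.\<close>

lemma fps2_nth_suminf_linear:
  fixes c d :: "'a::real_field"
  shows "fps2_nth (fps2_suminf
             (\<lambda>k. fps2_const (f k / fact k) * (fps2_const c * T1 + fps2_const d * T2) ^ k)) m n =
           f (m + n) * c ^ m * d ^ n / (fact m * fact n)"
proof -
  let ?g = "\<lambda>k. fps2_nth
    (fps2_const (f k / fact k) * (fps2_const c * T1 + fps2_const d * T2) ^ k) m n"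
  have "Sum_any ?g = sum ?g {m + n}"
    by (rule Sum_any.expand_superset)
      (auto simp: fps2_nth_const_mult fps2_nth_linear_power split: if_splits)
  \<comment> \<open>The binomial coefficient of \<open>m + n\<close> over \<open>m\<close>, divided
    by \<open>(m + n)!\<close>, is \<open>1 / (m! n!)\<close>.\<close>
  also have "\<dots> = f (m + n) * c ^ m * d ^ n / (fact m * fact n)"
    by (simp add: fps2_nth_const_mult fps2_nth_linear_power binomial_fact)
  finally show ?thesis
    by (simp add: fps2_nth_suminf)
qed

lemma fps2_nth_exp_linear:
  fixes c d :: "'a::real_field"
  shows "fps2_nth (fps2_exp (fps2_const c * T1 + fps2_const d * T2)) m n =
           c ^ m * d ^ n / (fact m * fact n)"
  using fps2_nth_suminf_linear[of "\<lambda>_. 1" c d m n] by (simp add: fps2_exp_def)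

lemma fps2_nth_one_plus_powr:
  fixes x :: "'a::real_field"
  shows "fps2_nth (fps2_one_plus_powr (T1 + T2) x) m n =
           falling_factorial x (m + n) / (fact m * fact n)"
  using fps2_nth_suminf_linear[of "falling_factorial x" 1 1 m n]
  by (simp add: fps2_one_plus_powr_def)

lemma fps2_nth_suminf_double:
  "fps2_nth (fps2_suminf (\<lambda>i. fps2_suminf (\<lambda>j. fps2_const (c i j) * (T1 ^ i * T2 ^ j)))) m n
     = c m n" for c :: "nat \<Rightarrow> nat \<Rightarrow> 'a::comm_ring_1"
proof -
  have "Sum_any (\<lambda>i. if m = i then c i n else 0) = (\<Sum>i\<in>{m}. if m = i then c i n else 0)"
    by (rule Sum_any.expand_superset) (auto split: if_splits)
  \<comment> \<open>\<open>fps2_nth_suminf\<close> unfolds the inner series as well, so the rule for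
    it is needed in unfolded form.\<close>
  then show ?thesis
    by (simp add: fps2_nth_suminf fps2_nth_suminf_inner[unfolded fps2_nth_suminf])
qed

text \<open>Division by the factorials turns each binomial coefficient into two reciprocal
  factorials. Reflecting both indices then lets \<open>i\<close> and \<open>j\<close> count the
  powers from the exponential factor, as in \<open>fps2_nth_mult\<close>.\<close>

lemma charlier_div_fact:
  fixes x :: "'a::real_field"
  shows "charlier a1 a2 m n x / (fact m * fact n) =
    (\<Sum>i=0..m. \<Sum>j=0..n. (- of_real a1) ^ i * (- of_real a2) ^ j / (fact i * fact j) *
       (falling_factorial x ((m - i) + (n - j)) / (fact (m - i) * fact (n - j))))"
proof -
  have "charlier a1 a2 m n x / (fact m * fact n) =
    (\<Sum>k=0..m. \<Sum>l=0..n.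
       (- of_real a1) ^ (m - k) * (- of_real a2) ^ (n - l) / (fact (m - k) * fact (n - l)) *
       (falling_factorial x (k + l) / (fact k * fact l)))"
    unfolding charlier_def sum_divide_distrib
    by (intro sum.cong refl) (simp add: binomial_fact ac_simps)
  also have "\<dots> =
    (\<Sum>i=0..m. \<Sum>j=0..n. (- of_real a1) ^ i * (- of_real a2) ^ j / (fact i * fact j) *
       (falling_factorial x ((m - i) + (n - j)) / (fact (m - i) * fact (n - j))))"
    by (subst sum.atLeastAtMost_rev, rule sum.cong[OF refl], subst sum.atLeastAtMost_rev) simp
  finally show ?thesis .
qed

theorem theorem2:
  fixes a1 a2 :: real and x :: "'a::real_field"
  assumes "a1 > 0" and "a2 > 0"
  shows "fps2_exp (- (fps2_const (of_real a1) * T1 + fps2_const (of_real a2) * T2))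
           * fps2_one_plus_powr (T1 + T2) x
       = fps2_suminf (\<lambda>n1. fps2_suminf (\<lambda>n2.
           fps2_const (charlier a1 a2 n1 n2 x / (fact n1 * fact n2)) * (T1 ^ n1 * T2 ^ n2)))"
proof (rule fps2_eqI)
  fix m n
  \<comment> \<open>The sign moves into the constants, so that the exponent is a linear form as in
    \<open>fps2_nth_exp_linear\<close>.\<close>
  have "- (fps2_const (of_real a1 :: 'a) * T1 + fps2_const (of_real a2) * T2) =
      fps2_const (- of_real a1) * T1 + fps2_const (- of_real a2) * T2"
    by (simp add: fps2_const_uminus)
  then show "fps2_nth (fps2_exp (- (fps2_const (of_real a1) * T1 + fps2_const (of_real a2) * T2))
        * fps2_one_plus_powr (T1 + T2) x) m n
      = fps2_nth (fps2_suminf (\<lambda>n1. fps2_suminf (\<lambda>n2.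
           fps2_const (charlier a1 a2 n1 n2 x / (fact n1 * fact n2)) * (T1 ^ n1 * T2 ^ n2)))) m n"
    by (simp only: fps2_nth_mult fps2_nth_exp_linear fps2_nth_one_plus_powr
        fps2_nth_suminf_double charlier_div_fact)
qed

end
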